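(* The space of probabilities satisfying both influence and independence for $n=3$ is $$\mathrm{GST}_3=\{(p_1,p_2,p_3)\in[0,1]^3:\ p_1-4p_2+3p_3=0\}\setminus\{(p_1,p_2,p_3): p_1=p_2=p_3\},$$ and this set consists of exactly two connected components.
   Context: Let $n=3$ and $\mathbf p=(p_1,p_2,p_3)\in[0,1]^3$. For $x\in\{0,1\}^3$ and $i\in\{1,2,3\}$ put $\pi_i(x)=p_k$ with $k=\#\{j: x_j=x_i\}$. Model: causes $C_1,C_2,C_3$ are independent fair $\{0,1\}$-valued random variables; effects $E_1,E_2,E_3$ are $\{0,1\}$-valued, conditionally independent given $(C_1,C_2,C_3)$, with $\mathbb P(E_i=1\mid (C_1,C_2,C_3)=x)=\pi_i(x)$. $\mathbf p$ satisfies independence if $E_1,E_2,E_3$ are pairwise independent. $\mathbf p$ satisfies influence if for all $i,j\in\{1,2,3\}$ there is $x\in\{0,1\}^3$ such that $\pi_i(x)\neq\pi_i(x')$, where $x'$ is $x$ with its $j$-th coordinate flipped. $\mathrm{GST}_3$ is the set of $\mathbf p\in[0,1]^3$ satisfying both independence and influence. *)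

theory Defs
  imports "HOL-Probability.Probability"
begin

text \<open>
  The value 1 of a cause or an effect is \<open>True\<close>, the value 0 is \<open>False\<close>.
  Causes, effects and the coordinates of the parameter vector are all indexed by the three-element
  type \<open>3\<close>, where \<open>3 = 0\<close>; so \<open>of_nat\<close> sends the cardinalities 1, 2, 3
  to the three distinct indices 1, 2, 3.
\<close>

definition effect_prob :: "real^3 \<Rightarrow> 3 \<Rightarrow> (3 \<Rightarrow> bool) \<Rightarrow> real" where
  "effect_prob p i x = p $ of_nat (card {j. x j = x i})"

definition causes_pmf :: "(3 \<Rightarrow> bool) pmf" where
  "causes_pmf = Pi_pmf UNIV False (\<lambda>_. bernoulli_pmf (1/2))"

definition effects_pmf :: "real^3 \<Rightarrow> (3 \<Rightarrow> bool) \<Rightarrow> (3 \<Rightarrow> bool) pmf" where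
  "effects_pmf p x = Pi_pmf UNIV False (\<lambda>i. bernoulli_pmf (effect_prob p i x))"

text \<open>The joint law of (causes, effects).\<close>

definition model :: "real^3 \<Rightarrow> ((3 \<Rightarrow> bool) \<times> (3 \<Rightarrow> bool)) pmf" where
  "model p = do {x \<leftarrow> causes_pmf; e \<leftarrow> effects_pmf p x; return_pmf (x, e)}"

definition effect :: "3 \<Rightarrow> (3 \<Rightarrow> bool) \<times> (3 \<Rightarrow> bool) \<Rightarrow> bool" where
  "effect i \<omega> = snd \<omega> i"

definition unit_cube :: "(real^3) set" where
  "unit_cube = {p. \<forall>k. 0 \<le> p $ k \<and> p $ k \<le> 1}"

definition independence :: "real^3 \<Rightarrow> bool" where
  "independence p \<longleftrightarrow>
     (\<forall>i j. i \<noteq> j \<longrightarrow>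
        prob_space.indep_var (measure_pmf (model p))
          (count_space UNIV) (effect i) (count_space UNIV) (effect j))"

definition influence :: "real^3 \<Rightarrow> bool" where
  "influence p \<longleftrightarrow>
     (\<forall>i j. \<exists>x. effect_prob p i x \<noteq> effect_prob p i (x(j := \<not> x j)))"

definition GST3 :: "(real^3) set" where
  "GST3 = {p \<in> unit_cube. independence p \<and> influence p}"

text \<open>
  \<open>bernoulli_pmf\<close> clamps its argument to the unit interval, so \<open>model p\<close> is meaningful
  only for \<open>p \<in> unit_cube\<close>; there no clamping takes place and the joint law factors as prescribed.
\<close>

lemma pmf_model:
  assumes "p \<in> unit_cube"
  shows "pmf (model p) (x, e) =
    (1/2)^3 * (\<Prod>i\<in>UNIV. if e i then effect_prob p i x else 1 - effect_prob p i x)"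
proof -
  have range: "0 \<le> effect_prob p i x \<and> effect_prob p i x \<le> 1" for i
    using assms by (simp add: unit_cube_def effect_prob_def)
  have "model p = bind_pmf causes_pmf (\<lambda>x. map_pmf (Pair x) (effects_pmf p x))"
    by (simp add: model_def map_pmf_def)
  hence "pmf (model p) (x, e) =
      measure_pmf.expectation causes_pmf (\<lambda>y. pmf (map_pmf (Pair y) (effects_pmf p y)) (x, e))"
    by (simp add: pmf_bind)
  also have "\<dots> = measure_pmf.expectation causes_pmf
      (\<lambda>y. indicator {x} y * pmf (effects_pmf p x) e)"
  proof (rule Bochner_Integration.integral_cong)
    fix y
    show "pmf (map_pmf (Pair y) (effects_pmf p y)) (x, e) =
        indicator {x} y * pmf (effects_pmf p x) e"
    proof (cases "y = x")
      case True
      thus ?thesis by (simp add: pmf_map_inj' inj_def)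
    next
      case False
      hence "(x, e) \<notin> set_pmf (map_pmf (Pair y) (effects_pmf p y))" by auto
      hence "pmf (map_pmf (Pair y) (effects_pmf p y)) (x, e) = 0"
        by (simp only: set_pmf_iff not_not)
      with False show ?thesis by simp
    qed
  qed simp
  also have "\<dots> = pmf causes_pmf x * pmf (effects_pmf p x) e"
    by (simp add: measure_pmf_single)
  also have "pmf causes_pmf x = (1/2)^3"
  proof -
    have "pmf (bernoulli_pmf (1/2)) b = 1/2" for b
      by (cases b) simp_all
    thus ?thesis by (simp add: causes_pmf_def pmf_Pi)
  qed
  also have "pmf (effects_pmf p x) e =
      (\<Prod>i\<in>UNIV. if e i then effect_prob p i x else 1 - effect_prob p i x)"
    using range by (auto simp: effects_pmf_def pmf_Pi intro!: prod.cong)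
  finally show ?thesis .
qed

end

theory Submission
  imports Defs
begin

text \<open>
  Averaging over the causes, P(E_i) = (p_1 + 2 p_2 + p_3) / 4 and, for distinct i and j,
  P(E_i and E_j) = (p_3^2 + p_2^2 + 2 p_1 p_2) / 4. The difference between the latter and
  P(E_i) P(E_j) factors as -(p_1 - p_3) (p_1 - 4 p_2 + 3 p_3) / 16, while influence means that
  p_1 and p_3 differ (taking i = j, a flip that isolates or rejoins a cause exchanges p_1 and p_3).
  What remains is a convex piece of a plane cut by the line p_1 = p_3 into two convex halves.
\<close>

section \<open>Independence of two Boolean random variables\<close>

text \<open>A Boolean variable generates only four events, and the product rule passes to
  complements by subtraction from a marginal, so the true/true case decides independence.\<close>

lemma (in prob_space) indep_var_bool_iff:
  fixes X Y :: "'a \<Rightarrow> bool"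
  assumes [measurable]: "X \<in> measurable M (count_space UNIV)" "Y \<in> measurable M (count_space UNIV)"
  shows "indep_var (count_space UNIV) X (count_space UNIV) Y \<longleftrightarrow>
    \<P>(w in M. X w \<and> Y w) = \<P>(w in M. X w) * \<P>(w in M. Y w)"
    (is "?L \<longleftrightarrow> ?R")
proof
  assume ?L
  from indep_varD[OF this, of "{True}" "{True}"] show ?R
    by (simp add: vimage_def Int_def conj_commute)
next
  assume R: ?R
  have cases: "A = {} \<or> A = {True} \<or> A = {False} \<or> A = UNIV" for A :: "bool set"
    using UNIV_I[of A] unfolding Pow_UNIV[symmetric] UNIV_bool Pow_insert by auto
  have compl: "\<P>(w in M. \<not> Z w) = 1 - \<P>(w in M. Z w)"
    if "Z \<in> measurable M (count_space UNIV)" for Z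
    using that by (intro prob_neg) simp
  have split: "\<P>(w in M. Z w) = \<P>(w in M. Z w \<and> W w) + \<P>(w in M. Z w \<and> \<not> W w)"
    if [measurable]: "Z \<in> measurable M (count_space UNIV)" "W \<in> measurable M (count_space UNIV)" for Z W
    by (subst finite_measure_Union[symmetric]) (auto intro!: arg_cong[where f=prob])
  have split': "\<P>(w in M. Z w) = \<P>(w in M. W w \<and> Z w) + \<P>(w in M. \<not> W w \<and> Z w)"
    if [measurable]: "Z \<in> measurable M (count_space UNIV)" "W \<in> measurable M (count_space UNIV)" for Z W
    by (subst finite_measure_Union[symmetric]) (auto intro!: arg_cong[where f=prob])
  have XnY: "\<P>(w in M. X w \<and> \<not> Y w) = \<P>(w in M. X w) * \<P>(w in M. \<not> Y w)"
    using R split[of X Y] by (simp add: compl algebra_simps)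
  have nXY: "\<P>(w in M. \<not> X w \<and> Y w) = \<P>(w in M. \<not> X w) * \<P>(w in M. Y w)"
    using R split'[of Y X] by (simp add: compl algebra_simps)
  have nXnY: "\<P>(w in M. \<not> X w \<and> \<not> Y w) = \<P>(w in M. \<not> X w) * \<P>(w in M. \<not> Y w)"
    using nXY split[of "\<lambda>w. \<not> X w" Y] by (simp add: compl algebra_simps)
  have prod: "prob ((X -` A \<inter> space M) \<inter> (Y -` B \<inter> space M)) =
      prob (X -` A \<inter> space M) * prob (Y -` B \<inter> space M)" for A B
  proof -
    have "\<P>(w in M. X w \<in> A \<and> Y w \<in> B) = \<P>(w in M. X w \<in> A) * \<P>(w in M. Y w \<in> B)"
      using cases[of A] cases[of B] R XnY nXY nXnY by (elim disjE) (simp_all add: prob_space)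
    moreover have "(X -` A \<inter> space M) \<inter> (Y -` B \<inter> space M) = {w \<in> space M. X w \<in> A \<and> Y w \<in> B}"
      "Z -` C \<inter> space M = {w \<in> space M. Z w \<in> C}" for Z :: "'a \<Rightarrow> bool" and C
      by auto
    ultimately show ?thesis by simp
  qed
  \<comment> \<open>\<open>indep_var_eq\<close> speaks of generated sigma-algebras; since the
    preimage families are closed under intersection, the product rule on these generators is
    enough.\<close>
  let ?E = "\<lambda>Z. {Z -` A \<inter> space M |A. A \<in> sets (count_space (UNIV :: bool set))}"
  have stable: "Int_stable (?E Z)" for Z
  proof (rule Int_stableI)
    fix a b assume "a \<in> ?E Z" "b \<in> ?E Z"
    then obtain A B where "a = Z -` A \<inter> space M" "b = Z -` B \<inter> space M" by auto
    hence "a \<inter> b = Z -` (A \<inter> B) \<inter> space M" by auto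
    thus "a \<inter> b \<in> ?E Z"
      by (intro CollectI exI[of _ "A \<inter> B"] conjI) (assumption, simp)
  qed
  have "indep_set (?E X) (?E Y)"
  proof (rule indep_setI)
    fix a b assume "a \<in> ?E X" "b \<in> ?E Y"
    then obtain A B where "a = X -` A \<inter> space M" "b = Y -` B \<inter> space M" by auto
    thus "prob (a \<inter> b) = prob a * prob b" by (simp only: prod)
  qed (use assms[THEN measurable_sets] in auto)
  thus ?L
    unfolding indep_var_eq using assms indep_set_sigma_sets[OF _ stable stable] by simp
qed

section \<open>Probabilities of effects in the model\<close>

lemma prob_effects:
  assumes "p \<in> unit_cube"
  shows "measure_pmf.prob (effects_pmf p x) {e. \<forall>k\<in>K. e k} = (\<Prod>k\<in>K. effect_prob p k x)"
proof -
  have range: "0 \<le> effect_prob p k x \<and> effect_prob p k x \<le> 1" for k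
    using assms by (simp add: unit_cube_def effect_prob_def)
  \<comment> \<open>The event is a box whose factors outside \<open>K\<close> have mass 1. The index
    set is \<open>UNIV\<close>, so the default \<open>False\<close> never occurs.\<close>
  have "{e. \<forall>k\<in>K. e k} = PiE_dflt UNIV False (\<lambda>k. if k \<in> K then {True} else UNIV)"
    by (auto simp: PiE_dflt_def split: if_splits)
  hence "measure_pmf.prob (effects_pmf p x) {e. \<forall>k\<in>K. e k} =
      (\<Prod>k\<in>UNIV. if k \<in> K then effect_prob p k x else 1)"
    using range by (auto simp: effects_pmf_def measure_Pi_pmf_PiE_dflt measure_pmf_single intro!: prod.cong)
  thus ?thesis by (simp add: prod.If_cases)
qed

text \<open>Condition on the causes: each of the eight cause vectors has weight 1/8, and given the
  causes the effects are independent.\<close>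

lemma prob_model_effects:
  assumes "p \<in> unit_cube"
  shows "measure_pmf.prob (model p) {\<omega>. \<forall>k\<in>K. effect k \<omega>} =
    (\<Sum>x\<in>UNIV. \<Prod>k\<in>K. effect_prob p k x) / 8"
proof -
  \<comment> \<open>Writing an event's probability as a point mass of an image makes
    \<open>pmf_bind\<close> applicable.\<close>
  have prob_map: "measure_pmf.prob M {w. Z w} = pmf (map_pmf Z M) True"
    for M :: "'c pmf" and Z
    by (simp add: pmf_map vimage_def)
  have causes: "pmf causes_pmf x = 1/8" for x
    by (simp add: causes_pmf_def pmf_Pi power3_eq_cube)
  have "model p = bind_pmf causes_pmf (\<lambda>x. map_pmf (Pair x) (effects_pmf p x))"
    by (simp add: model_def map_pmf_def)
  hence "measure_pmf.prob (model p) {\<omega>. \<forall>k\<in>K. effect k \<omega>} =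
      measure_pmf.expectation causes_pmf (\<lambda>x. pmf (map_pmf (\<lambda>e. \<forall>k\<in>K. e k) (effects_pmf p x)) True)"
    by (simp add: prob_map map_bind_pmf pmf_bind map_pmf_comp effect_def)
  also have "\<dots> = measure_pmf.expectation causes_pmf (\<lambda>x. \<Prod>k\<in>K. effect_prob p k x)"
    by (simp add: prob_map[symmetric] prob_effects[OF assms])
  also have "\<dots> = (\<Sum>x\<in>UNIV. (\<Prod>k\<in>K. effect_prob p k x) * pmf causes_pmf x)"
    by (rule integral_measure_pmf_real) simp_all
  finally show ?thesis
    by (simp only: causes sum_divide_distrib mult_1_right times_divide_eq_right)
qed

text \<open>A function on three points is its triple of values. Leaving \<open>i\<close>,
  \<open>j\<close>, \<open>l\<close> generic spares a case split over concrete indices.\<close>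

lemma sum_UNIV_fun_bool_3:
  fixes F :: "('a::finite \<Rightarrow> bool) \<Rightarrow> 'b::comm_monoid_add"
  assumes "UNIV = {i, j, l}" "i \<noteq> j" "i \<noteq> l" "j \<noteq> l"
  shows "(\<Sum>x\<in>UNIV. F x) = (\<Sum>a\<in>UNIV. \<Sum>b\<in>UNIV. \<Sum>c\<in>UNIV. F ((\<lambda>_. c)(i := a, j := b)))"
proof -
  have x_eq: "(\<lambda>_. x l)(i := x i, j := x j) = x" for x :: "'a \<Rightarrow> bool"
  proof
    fix k
    have "k \<in> {i, j, l}" using assms(1) by blast
    thus "((\<lambda>_. x l)(i := x i, j := x j)) k = x k" by auto
  qed
  have "(\<Sum>x\<in>UNIV. F x) = (\<Sum>(a, b, c)\<in>UNIV. F ((\<lambda>_. c)(i := a, j := b)))"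
    by (rule sum.reindex_bij_witness[where i="\<lambda>(a, b, c). (\<lambda>_. c)(i := a, j := b)"
        and j="\<lambda>x. (x i, x j, x l)"]) (use assms in \<open>auto simp: x_eq\<close>)
  thus ?thesis
    by (simp add: UNIV_Times_UNIV[symmetric] sum.cartesian_product del: UNIV_Times_UNIV)
qed

lemma third_index:
  fixes i j :: 3
  assumes "i \<noteq> j"
  obtains l where "UNIV = {i, j, l}" "l \<noteq> i" "l \<noteq> j"
proof -
  have "card (UNIV - {i, j}) = 1"
    using assms by (simp add: card_Diff_subset)
  then obtain l where "UNIV - {i, j} = {l}"
    by (rule card_1_singletonE)
  thus ?thesis
    by (intro that[of l]) blast+
qed

text \<open>The class of \<open>i\<close> has size 3, 2 or 1 according to whether both, one or none
  of the other causes agree with \<open>x i\<close>.\<close>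

lemma effect_prob_eq:
  assumes "UNIV = {i, j, l}" "i \<noteq> j" "l \<noteq> i" "l \<noteq> j"
  shows "effect_prob p i x =
    (if x j = x i then if x l = x i then p $ 3 else p $ 2
     else if x l = x i then p $ 2 else p $ 1)"
proof -
  have "{k. x k = x i} = (if x j = x i then if x l = x i then {i, j, l} else {i, j}
     else if x l = x i then {i, l} else {i})"
    using assms(1) by (auto simp: set_eq_iff)
  thus ?thesis using assms(2-) by (auto simp: effect_prob_def)
qed

text \<open>Among the eight cause vectors, the class of \<open>i\<close> has size 1, 2, 3 in two,
  four and two cases.\<close>

lemma prob_effect:
  assumes "p \<in> unit_cube"
  shows "measure_pmf.prob (model p) {\<omega>. effect i \<omega>} = (p $ 1 + 2 * p $ 2 + p $ 3) / 4"
proof -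
  obtain j :: 3 where "j \<noteq> i" using zero_neq_one by metis
  then obtain l where l: "UNIV = {i, j, l}" "l \<noteq> i" "l \<noteq> j"
    by (metis third_index)
  show ?thesis
    using prob_model_effects[OF assms, of "{i}"] l \<open>j \<noteq> i\<close>
    by (simp add: sum_UNIV_fun_bool_3[of i j l] effect_prob_eq[of i j l] UNIV_bool field_simps)
qed

text \<open>Two cause vectors are constant; in two, only \<open>l\<close> deviates; in the other
  four, \<open>i\<close> and \<open>j\<close> differ and \<open>l\<close> sides with one of them,
  giving the mixed product.\<close>

lemma prob_effect_pair:
  assumes "p \<in> unit_cube" "i \<noteq> j"
  shows "measure_pmf.prob (model p) {\<omega>. effect i \<omega> \<and> effect j \<omega>} =
    ((p $ 3)\<^sup>2 + (p $ 2)\<^sup>2 + 2 * p $ 1 * p $ 2) / 4"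
proof -
  obtain l where l: "UNIV = {i, j, l}" "l \<noteq> i" "l \<noteq> j"
    by (metis third_index assms(2))
  have l': "UNIV = {j, i, l}" using l by auto
  show ?thesis
    using prob_model_effects[OF assms(1), of "{i, j}"] l assms(2)
    by (simp add: sum_UNIV_fun_bool_3[of i j l] effect_prob_eq[OF l(1)] effect_prob_eq[OF l']
        UNIV_bool power2_eq_square field_simps)
qed

section \<open>Independence and influence as conditions on the parameters\<close>

lemma independence_iff:
  assumes "p \<in> unit_cube"
  shows "independence p \<longleftrightarrow> (p $ 1 - p $ 3) * (p $ 1 - 4 * p $ 2 + 3 * p $ 3) = 0"
proof -
  have "independence p \<longleftrightarrow> (\<forall>i j :: 3. i \<noteq> j \<longrightarrow>
      ((p $ 3)\<^sup>2 + (p $ 2)\<^sup>2 + 2 * p $ 1 * p $ 2) / 4 = ((p $ 1 + 2 * p $ 2 + p $ 3) / 4)\<^sup>2)"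
    by (simp add: independence_def prob_space.indep_var_bool_iff[OF prob_space_measure_pmf]
        prob_effect prob_effect_pair assms power2_eq_square)
  also have "\<dots> \<longleftrightarrow>
      ((p $ 3)\<^sup>2 + (p $ 2)\<^sup>2 + 2 * p $ 1 * p $ 2) / 4 = ((p $ 1 + 2 * p $ 2 + p $ 3) / 4)\<^sup>2"
    \<comment> \<open>The equation does not mention \<open>i\<close> and \<open>j\<close>, so one
      pair of distinct indices suffices to drop the quantifiers.\<close>
    using one_neq_zero[where 'a=3] by blast
  also have "\<dots> \<longleftrightarrow> (p $ 1 - p $ 3) * (p $ 1 - 4 * p $ 2 + 3 * p $ 3) = 0"
  proof -
    have "((p $ 3)\<^sup>2 + (p $ 2)\<^sup>2 + 2 * p $ 1 * p $ 2) / 4 - ((p $ 1 + 2 * p $ 2 + p $ 3) / 4)\<^sup>2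
        = - ((p $ 1 - p $ 3) * (p $ 1 - 4 * p $ 2 + 3 * p $ 3)) / 16"
      by (simp add: power2_eq_square field_simps)
    thus ?thesis by auto
  qed
  finally show ?thesis .
qed

lemma influence_iff: "influence p \<longleftrightarrow> p $ 1 \<noteq> p $ 3"
proof
  assume "influence p"
  then obtain x where x: "effect_prob p 1 x \<noteq> effect_prob p 1 (x(1 := \<not> x 1))"
    unfolding influence_def by blast
  \<comment> \<open>Flipping a cause's own value keeps a class of size 2 and exchanges sizes 1 and
    3.\<close>
  from x show "p $ 1 \<noteq> p $ 3"
    by (auto simp: effect_prob_eq[OF UNIV_3] split: if_splits)
next
  assume neq: "p $ 1 \<noteq> p $ 3"
  have "\<exists>x. effect_prob p i x \<noteq> effect_prob p i (x(j := \<not> x j))" for i j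
  proof (cases "j = i")
    case True
    have "effect_prob p i (\<lambda>_. False) = p $ 3"
      by (simp add: effect_prob_def)
    moreover have "effect_prob p i ((\<lambda>_. False)(i := True)) = p $ 1"
    proof -
      have "{k. ((\<lambda>_. False)(i := True)) k = True} = {i}" by auto
      thus ?thesis by (simp add: effect_prob_def)
    qed
    ultimately show ?thesis using neq True by (intro exI[of _ "\<lambda>_. False"]) simp
  next
    case False
    then obtain l where l: "UNIV = {i, j, l}" "l \<noteq> i" "l \<noteq> j"
      by (metis third_index)
    note eq = effect_prob_eq[OF l(1) False[symmetric] l(2,3)]
    show ?thesis
    \<comment> \<open>As \<open>p $ 1\<close> and \<open>p $ 3\<close> differ, \<open>p $ 2\<close>
      differs from one of them. Flipping \<open>j\<close> turns size 2 into size 1 if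
      \<open>l\<close> deviates from \<open>i\<close>, and size 3 into size 2 if all causes
      agree.\<close>
    proof (cases "p $ 2 = p $ 3")
      case True
      show ?thesis
        using True neq False l by (intro exI[of _ "(\<lambda>_. False)(l := True)"]) (simp add: eq)
    next
      case False
      show ?thesis
        using False \<open>j \<noteq> i\<close> l by (intro exI[of _ "\<lambda>_. False"]) (simp add: eq)
    qed
  qed
  thus "influence p" by (simp add: influence_def)
qed

section \<open>Connected components\<close>

text \<open>A connected subset of the union cannot meet both \<open>A\<close> and \<open>B\<close>,
  so it lies in \<open>U\<close> or in \<open>V\<close>; these two are therefore the maximal
  connected subsets.\<close>

lemma components_two_separated:
  assumes "connected U" "connected V" "U \<noteq> {}" "V \<noteq> {}"
    and "open A" "open B" "U \<subseteq> A" "V \<subseteq> B" "A \<inter> B = {}"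
  shows "components (U \<union> V) = {U, V}"
proof -
  have side: "D \<subseteq> U \<or> D \<subseteq> V" if "connected D" "D \<subseteq> U \<union> V" for D
    using connectedD[OF that(1), of A B] assms that(2) by blast
  have disjoint: "U \<inter> V = {}"
    using assms by blast
  have "C \<in> components (U \<union> V) \<longleftrightarrow> C = U \<or> C = V" for C
  proof
    assume "C \<in> components (U \<union> V)"
    thus "C = U \<or> C = V"
      unfolding in_components_maximal using side[of C] assms(1-4) by (metis Un_upper1 Un_upper2)
  next
    assume "C = U \<or> C = V"
    moreover have "D = C" if "C \<subseteq> D" "D \<subseteq> U \<union> V" "connected D" for D
      using side[OF that(3,2)] calculation that(1) disjoint assms(3,4) by blast
    ultimately show "C \<in> components (U \<union> V)"
      unfolding in_components_maximal using assms(1-4) by auto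
  qed
  thus ?thesis by blast
qed

theorem mainTheorem3:
  "GST3 = {p \<in> unit_cube. p $ 1 - 4 * p $ 2 + 3 * p $ 3 = 0}
          - {p. p $ 1 = p $ 2 \<and> p $ 2 = p $ 3}
   \<and> card (components GST3) = 2"
proof
  let ?plane = "{p \<in> unit_cube. p $ 1 - 4 * p $ 2 + 3 * p $ 3 = 0}"
  \<comment> \<open>On the plane, \<open>p $ 1 = p $ 3\<close> forces \<open>p $ 2\<close> to the
    same value, so removing the diagonal amounts to requiring
    \<open>p $ 1 \<noteq> p $ 3\<close>.\<close>
  show eq: "GST3 = ?plane - {p. p $ 1 = p $ 2 \<and> p $ 2 = p $ 3}"
    by (auto simp: GST3_def independence_iff influence_iff)
  let ?U = "?plane \<inter> {p. p $ 1 < p $ 3}" and ?V = "?plane \<inter> {p. p $ 1 > p $ 3}"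
  have GST3: "GST3 = ?U \<union> ?V"
    unfolding eq by auto
  have "unit_cube = cbox 0 1"
    by (auto simp: unit_cube_def mem_box_cart)
  moreover have "p $ 1 - 4 * p $ 2 + 3 * p $ 3 = vector [1, -4, 3] \<bullet> p" for p :: "real^3"
    by (simp add: inner_vec_def sum_3)
  ultimately have plane: "convex ?plane"
    using convex_Int[OF convex_box(1) convex_hyperplane, of 0 1 "vector [1, -4, 3] :: real^3" 0]
    by (simp add: Int_def)
  have less: "open {p :: real^3. p $ 1 < p $ 3}" "open {p :: real^3. p $ 1 > p $ 3}"
    by (auto intro!: open_Collect_less continuous_intros)
  have "convex {p :: real^3. p $ 1 < p $ 3}" "convex {p :: real^3. p $ 1 > p $ 3}"
    by (auto simp: convex_alt) (smt (verit, best) mult_left_mono mult_strict_left_mono)+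
  hence "connected ?U" "connected ?V"
    using plane by (auto intro!: convex_connected convex_Int)
  \<comment> \<open>Extreme values for the outer coordinates, with the middle one solved from the
    plane equation as (p_1 + 3 p_3) / 4.\<close>
  moreover have U: "vector [0, 3/4, 1] \<in> ?U" and "vector [1, 1/4, 0] \<in> ?V"
    by (auto simp: unit_cube_def forall_3)
  ultimately have "components GST3 = {?U, ?V}"
    unfolding GST3
    by (intro components_two_separated[OF _ _ _ _ less]) (blast | force)+
  moreover have "?U \<noteq> ?V"
    using U by auto
  ultimately show "card (components GST3) = 2"
    by simp
qed

end
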